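(* Let $A_1$ and $A_2$ be two commuting, positive definite (symmetric) real $n\times n$ matrices and let $b_1,b_2\in\mathbb{R}^n$. Define for $x\in\mathbb{R}^n$ $$T_i x=A_i x+b_i,\qquad i=1,2 .$$ Then all $C^1$ solutions $f:\mathbb{R}^n\to\mathbb{R}$ of the functional equation $$f(T_1x+T_2x)=f(T_1x)+f(T_2x),\qquad x\in\mathbb{R}^n,$$ are of the form $f(x)=c\cdot x$ for some constant vector $c\in\mathbb{R}^n$. *)

theory Defs
  imports "HOL-Analysis.Analysis"
begin

definition sym_pos_def :: "real ^ 'n ^ 'n \<Rightarrow> bool" where
  "sym_pos_def A \<longleftrightarrow> transpose A = A \<and> (\<forall>x. x \<noteq> 0 \<longrightarrow> 0 < x \<bullet> (A *v x))"

(* The derivative is required to be continuous in the operator norm. The library's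
   C1_differentiable_on covers only functions of one real variable. *)
definition C1 :: "('a::real_normed_vector \<Rightarrow> 'b::real_normed_vector) \<Rightarrow> bool" where
  "C1 f \<longleftrightarrow> (\<exists>f' :: 'a \<Rightarrow> 'a \<Rightarrow>\<^sub>L 'b.
     (\<forall>x. (f has_derivative blinfun_apply (f' x)) (at x)) \<and> continuous_on UNIV f')"

end

theory Submission
  imports Defs
begin

text \<open>
  Put \<open>A = A1 + A2\<close> and \<open>B = A1 A\<^sup>-\<^sup>1\<close>. Substituting \<open>y = T1 x + T2 x\<close> turns the equation into
  \<open>f y = f (S1 y) + f (S2 y)\<close>, where \<open>S1\<close>, \<open>S2\<close> are affine with linear parts \<open>B\<close> and \<open>I - B\<close>.
  As \<open>A1\<close> and \<open>A2\<close> commute, \<open>B\<close> is symmetric; its eigenvalues lie strictly between 0 and 1, so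
  \<open>S1\<close> and \<open>S2\<close> are contractions. For an eigenvector \<open>h\<close> of \<open>B\<close> with eigenvalue \<open>l\<close>, the
  directional derivative \<open>\<phi> y = f' y h\<close> satisfies \<open>\<phi> y = l \<phi> (S1 y) + (1 - l) \<phi> (S2 y)\<close>.
  At a maximum point of \<open>\<phi>\<close> on a large ball around the fixed point \<open>p\<close> of \<open>S1\<close>, this forces
  \<open>\<phi>\<close> to be maximal along the whole \<open>S1\<close>-orbit, hence at \<open>p\<close>; likewise for the minimum,
  so \<open>\<phi>\<close> is constant. Since the eigenvectors span, \<open>f'\<close> is constant.
\<close>

section \<open>Spectral theory of symmetric operators\<close>

text \<open>The Rayleigh quotient attains its maximum \<open>m\<close> on the compact unit sphere of
  \<open>W\<close>, and the variational condition at the maximiser is the eigenvector equation.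
  Allowing any invariant \<open>W\<close> makes this applicable to orthogonal complements.\<close>

lemma symmetric_maximal_eigenvector:
  fixes B :: "'a::euclidean_space \<Rightarrow> 'a"
  assumes "linear B" and sym: "\<And>x y. B x \<bullet> y = x \<bullet> B y"
    and W: "subspace W" "\<And>x. x \<in> W \<Longrightarrow> B x \<in> W" and "W \<noteq> {0}"
  obtains v m where "v \<in> W" "v \<noteq> 0" "B v = m *\<^sub>R v" "\<And>x. x \<in> W \<Longrightarrow> x \<bullet> B x \<le> m * (x \<bullet> x)"
proof -
  interpret B: linear B by fact
  have cont: "continuous_on X (\<lambda>x. x \<bullet> B x)" for X
    by (intro continuous_intros linear_continuous_on) (simp add: \<open>linear B\<close> linear_conv_bounded_linear [symmetric])
  obtain w where w: "w \<in> W" "w \<noteq> 0"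
    using \<open>W \<noteq> {0}\<close> subspace_0 [OF W(1)] by blast
  have "w /\<^sub>R norm w \<in> W \<inter> sphere 0 1"
    using w W(1) by (simp add: subspace_scale)
  moreover have "compact (W \<inter> sphere 0 1)"
    using W(1) by (intro closed_Int_compact closed_subspace) auto
  ultimately obtain v where v: "v \<in> W" "norm v = 1"
    and max: "\<And>y. \<lbrakk>y \<in> W; norm y = 1\<rbrakk> \<Longrightarrow> y \<bullet> B y \<le> v \<bullet> B v"
    using continuous_attains_sup [OF _ _ cont, of "W \<inter> sphere 0 1"]
    by (metis IntD1 IntD2 IntI dist_0_norm empty_iff mem_sphere)
  define m where "m = v \<bullet> B v"
  have bound: "x \<bullet> B x \<le> m * (x \<bullet> x)" if "x \<in> W" for x
  proof (cases "x = 0")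
    case False
    define u where "u = x /\<^sub>R norm x"
    have "u \<in> W" "norm u = 1" using False that W(1) by (auto simp: u_def subspace_scale)
    then have "u \<bullet> B u \<le> m" using max m_def by auto
    moreover have "x = norm x *\<^sub>R u" using False by (simp add: u_def)
    then have "x \<bullet> B x = (norm x)\<^sup>2 * (u \<bullet> B u)"
      by (metis B.scaleR inner_scaleR_left inner_scaleR_right mult.assoc power2_eq_square)
    ultimately show ?thesis
      by (simp add: dot_square_norm mult.commute [of m] mult_left_mono)
  qed simp
  define c where "c = m *\<^sub>R v - B v"
  define D where "D = (\<lambda>x. m *\<^sub>R x - B x)"
  have cW: "c \<in> W" using v W by (simp add: c_def subspace_diff subspace_scale)
  define K where "K = c \<bullet> D c"
  have K: "K \<ge> 0" using bound [OF cW] by (simp add: K_def D_def inner_diff_right)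
  \<comment> \<open>For \<open>K > 0\<close> the quadratic
    \<open>2 * t * (c \<bullet> c) + t\<^sup>2 * K\<close> is least at
    \<open>t = - (c \<bullet> c) / K\<close>; the denominator \<open>K + 1\<close> also covers
    \<open>K = 0\<close> and still gives a negative value unless \<open>c = 0\<close>.\<close>
  define t where "t = - (c \<bullet> c) / (K + 1)"
  \<comment> \<open>The form \<open>x \<bullet> D x\<close> is nonnegative on \<open>W\<close> and vanishes at \<open>v\<close>; moving from \<open>v\<close> along
    \<open>- D v\<close> would make it negative unless \<open>D v = 0\<close>.\<close>
  have "v + t *\<^sub>R c \<in> W" using v cW W(1) by (simp add: subspace_add subspace_scale)
  from bound [OF this] have "0 \<le> (v + t *\<^sub>R c) \<bullet> D (v + t *\<^sub>R c)"
    by (simp add: D_def inner_diff_right)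
  also have "D (v + t *\<^sub>R c) = c + t *\<^sub>R D c"
  proof -
    have "D (v + t *\<^sub>R c) = D v + t *\<^sub>R D c"
      by (simp add: D_def B.add B.scaleR algebra_simps)
    then show ?thesis by (simp add: D_def c_def)
  qed
  also have "(v + t *\<^sub>R c) \<bullet> (c + t *\<^sub>R D c) = v \<bullet> c + t * (c \<bullet> c) + t * (v \<bullet> D c) + t\<^sup>2 * K"
    by (simp add: K_def inner_add_left inner_add_right power2_eq_square algebra_simps)
  also have "v \<bullet> D c = c \<bullet> c"
    by (simp add: D_def c_def inner_diff_left inner_diff_right sym B.diff B.scaleR)
  also have "v \<bullet> c = 0"
    using v by (simp add: c_def inner_diff_right m_def dot_square_norm)
  finally have "0 \<le> 2 * t * (c \<bullet> c) + t\<^sup>2 * K" by simp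
  also have "\<dots> = - ((c \<bullet> c)\<^sup>2 * (K + 2) / (K + 1)\<^sup>2)"
    using K unfolding t_def by (simp add: divide_simps) (simp add: algebra_simps power2_eq_square)
  finally have "(c \<bullet> c)\<^sup>2 * (K + 2) / (K + 1)\<^sup>2 \<le> 0" by simp
  then have "c = 0"
    using K by (auto simp: divide_le_0_iff mult_le_0_iff)
  then have "B v = m *\<^sub>R v" by (simp add: c_def)
  with v bound that show thesis by force
qed

text \<open>By symmetry the orthogonal complement of all eigenvectors is invariant. Were it nonzero,
  it would contain an eigenvector, which would be orthogonal to itself.\<close>

lemma symmetric_eigenvectors_span:
  fixes B :: "'a::euclidean_space \<Rightarrow> 'a"
  assumes "linear B" and sym: "\<And>x y. B x \<bullet> y = x \<bullet> B y"
  shows "span {v. \<exists>m. B v = m *\<^sub>R v} = UNIV"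
proof -
  define E where "E = {v. \<exists>m. B v = m *\<^sub>R v}"
  define W where "W = E\<^sup>\<bottom>"
  have W: "W = {x. \<forall>v\<in>E. x \<bullet> v = 0}"
    by (auto simp: W_def orthogonal_comp_def orthogonal_def inner_commute)
  have sub: "subspace W" by (simp add: W_def subspace_orthogonal_comp)
  have inv: "B x \<in> W" if "x \<in> W" for x
    using that by (auto simp: W sym E_def)
  show ?thesis
  proof (rule ccontr)
    assume "\<not> ?thesis"
    then obtain a where "a \<noteq> 0" "\<forall>x\<in>span E. a \<bullet> x = 0"
      using span_not_UNIV_orthogonal [of E] by (auto simp: E_def)
    then have "a \<in> W" "a \<noteq> 0" by (auto simp: W intro: span_base)
    then have "W \<noteq> {0}" by blast
    then obtain v m where v: "v \<in> W" "v \<noteq> 0" "B v = m *\<^sub>R v"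
      using symmetric_maximal_eigenvector [OF assms sub inv] by metis
    then have "v \<in> E" by (auto simp: E_def)
    with v show False by (auto simp: W)
  qed
qed

text \<open>The square of \<open>norm (B x)\<close> is the quadratic form of \<open>B\<close>
  composed with itself, so it is bounded through the largest eigenvalue of that square; the root of
  this eigenvalue is the contraction factor.\<close>

lemma symmetric_contraction:
  fixes B :: "'a::euclidean_space \<Rightarrow> 'a"
  assumes "linear B" and sym: "\<And>x y. B x \<bullet> y = x \<bullet> B y"
    and eig: "\<And>v m. \<lbrakk>v \<noteq> 0; B v = m *\<^sub>R v\<rbrakk> \<Longrightarrow> 0 < m \<and> m < 1"
  obtains s where "0 \<le> s" "s < 1" "\<And>x. norm (B x) \<le> s * norm x"
proof -
  interpret B: linear B by fact
  have ne: "(UNIV :: 'a set) \<noteq> {0}"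
    by (rule UNIV_not_singleton)
  have "linear (\<lambda>x. B (B x))"
    using linear_compose [OF \<open>linear B\<close> \<open>linear B\<close>] by (simp add: o_def)
  then obtain v m where v: "v \<noteq> 0" "B (B v) = m *\<^sub>R v" and bound: "\<And>x. x \<bullet> B (B x) \<le> m * (x \<bullet> x)"
    using symmetric_maximal_eigenvector [of "\<lambda>x. B (B x)" UNIV] sym ne by (metis UNIV_I subspace_UNIV)
  have "m * (v \<bullet> v) = B v \<bullet> B v" using v by (simp add: sym)
  then have "m \<ge> 0"
    using v by (metis inner_ge_zero inner_gt_zero_iff zero_le_mult_iff not_le)
  define s where "s = sqrt m"
  have s: "s \<ge> 0" "m = s * s" using \<open>m \<ge> 0\<close> by (auto simp: s_def)
  \<comment> \<open>\<open>(B - s) (B + s) v = 0\<close>, so \<open>s\<close> or \<open>-s\<close> is an eigenvalue of \<open>B\<close>.\<close>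
  have "s < 1"
  proof (cases "B v + s *\<^sub>R v = 0")
    case True
    then have "B v = (- s) *\<^sub>R v" by (simp add: add_eq_0_iff2)
    from eig [OF v(1) this] s show ?thesis by simp
  next
    case False
    have "B (B v + s *\<^sub>R v) = s *\<^sub>R (B v + s *\<^sub>R v)"
      using v s by (simp add: B.add B.scaleR algebra_simps)
    from eig [OF False this] show ?thesis by simp
  qed
  moreover have "norm (B x) \<le> s * norm x" for x
  proof (rule power2_le_imp_le)
    have "(norm (B x))\<^sup>2 = x \<bullet> B (B x)" by (simp add: sym flip: dot_square_norm)
    also have "\<dots> \<le> m * (x \<bullet> x)" by (rule bound)
    also have "\<dots> = (s * norm x)\<^sup>2" by (simp add: s dot_square_norm power2_eq_square)
    finally show "(norm (B x))\<^sup>2 \<le> (s * norm x)\<^sup>2" .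
  qed (simp add: s)
  ultimately show thesis using that s by blast
qed

section \<open>Maximum principle for averages along contractions\<close>

lemma convex_average_le_fixpoint:
  fixes S1 S2 :: "'a::heine_borel \<Rightarrow> 'a" and \<phi> :: "'a \<Rightarrow> real"
  assumes s: "0 \<le> s" "s < 1"
    and S1: "\<And>x y. dist (S1 x) (S1 y) \<le> s * dist x y"
    and S2: "\<And>x y. dist (S2 x) (S2 y) \<le> s * dist x y"
    and p: "S1 p = p"
    and cont: "continuous_on UNIV \<phi>" and l: "0 < l" "l < 1"
    and avg: "\<And>y. \<phi> y = l * \<phi> (S1 y) + (1 - l) * \<phi> (S2 y)"
  shows "\<phi> x \<le> \<phi> p"
proof -
  \<comment> \<open>The first entry puts \<open>x\<close> in the ball; the second makes the ball
    invariant under \<open>S2\<close>, which need not fix \<open>p\<close>.\<close>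
  define R where "R = max (dist p x) (dist p (S2 p) / (1 - s))"
  have "dist p (S2 p) / (1 - s) \<le> R" by (simp add: R_def)
  then have R: "dist p (S2 p) + s * R \<le> R" using s by (simp add: field_simps)
  have x: "x \<in> cball p R" by (simp add: R_def)
  have S2K: "S2 z \<in> cball p R" if "z \<in> cball p R" for z
  proof -
    have "dist p (S2 z) \<le> dist p (S2 p) + s * dist p z"
      using dist_triangle [of p "S2 z" "S2 p"] S2 [of p z] by linarith
    also have "\<dots> \<le> dist p (S2 p) + s * R" using that s by (simp add: mult_left_mono)
    finally show ?thesis using R by simp
  qed
  have S1K: "S1 z \<in> cball p R" if "z \<in> cball p R" for z
  proof -
    have "dist p (S1 z) \<le> s * dist p z" using S1 [of p z] p by simp
    also have "\<dots> \<le> 1 * R" using that s by (intro mult_mono) auto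
    finally show ?thesis by simp
  qed
  obtain y where y: "y \<in> cball p R" and max: "\<And>z. z \<in> cball p R \<Longrightarrow> \<phi> z \<le> \<phi> y"
    using continuous_attains_sup [OF compact_cball _ continuous_on_subset [OF cont], of p R] x
    by (metis empty_iff subset_UNIV)
  have orbit: "(S1 ^^ n) y \<in> cball p R \<and> \<phi> ((S1 ^^ n) y) = \<phi> y" for n
  proof (induction n)
    case (Suc n)
    let ?z = "(S1 ^^ n) y"
    have "\<phi> (S2 ?z) \<le> \<phi> y" "\<phi> (S1 ?z) \<le> \<phi> y" using Suc S1K S2K max by auto
    moreover from \<open>\<phi> (S2 ?z) \<le> \<phi> y\<close> have "(1 - l) * \<phi> (S2 ?z) \<le> (1 - l) * \<phi> y"
      using l by (intro mult_left_mono) auto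
    \<comment> \<open>The value at \<open>?z\<close> is already maximal and the \<open>S2\<close>
      term cannot exceed its share, so the \<open>S1\<close> term must attain its own.\<close>
    then have "l * \<phi> y \<le> l * \<phi> (S1 ?z)"
      using avg [of ?z] Suc by (simp add: algebra_simps)
    then have "\<phi> y \<le> \<phi> (S1 ?z)" using l by simp
    ultimately show ?case using Suc S1K by auto
  qed (use y in simp)
  have "dist ((S1 ^^ n) y) p \<le> s ^ n * dist y p" for n
  proof (induction n)
    case (Suc n)
    have "dist (S1 ((S1 ^^ n) y)) p \<le> s * dist ((S1 ^^ n) y) p" using S1 p by metis
    also have "\<dots> \<le> s * (s ^ n * dist y p)" using Suc s by (intro mult_left_mono) auto
    finally show ?case by simp
  qed simp
  moreover have "(\<lambda>n. s ^ n * dist y p) \<longlonglongrightarrow> 0"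
    using s by (intro tendsto_mult_left_zero LIMSEQ_realpow_zero)
  ultimately have "(\<lambda>n. dist ((S1 ^^ n) y) p) \<longlonglongrightarrow> 0"
    by (auto intro: Lim_null_comparison [where g = "\<lambda>n. s ^ n * dist y p", OF always_eventually])
  then have "(\<lambda>n. (S1 ^^ n) y) \<longlonglongrightarrow> p" by (rule tendsto_dist_iff [THEN iffD2])
  then have "(\<lambda>n. \<phi> ((S1 ^^ n) y)) \<longlonglongrightarrow> \<phi> p"
    by (rule continuous_on_tendsto_compose [OF cont]) simp_all
  then have "\<phi> p = \<phi> y" by (simp only: orbit LIMSEQ_const_iff)
  then show ?thesis using max x by simp
qed

lemma convex_average_const:
  fixes S1 S2 :: "'a::{heine_borel, complete_space} \<Rightarrow> 'a" and \<phi> :: "'a \<Rightarrow> real"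
  assumes s: "0 \<le> s" "s < 1"
    and S1: "\<And>x y. dist (S1 x) (S1 y) \<le> s * dist x y"
    and S2: "\<And>x y. dist (S2 x) (S2 y) \<le> s * dist x y"
    and cont: "continuous_on UNIV \<phi>" and l: "0 < l" "l < 1"
    and avg: "\<And>y. \<phi> y = l * \<phi> (S1 y) + (1 - l) * \<phi> (S2 y)"
  shows "\<phi> x = \<phi> y"
proof -
  obtain p where p: "S1 p = p"
    using banach_fix_type [of s S1] s S1 by blast
  have "\<phi> z \<le> \<phi> p" for z
    by (rule convex_average_le_fixpoint [OF s S1 S2 p cont l avg])
  moreover have "- \<phi> z \<le> - \<phi> p" for z
  proof (rule convex_average_le_fixpoint [OF s S1 S2 p _ l])
    show "- \<phi> y = l * - \<phi> (S1 y) + (1 - l) * - \<phi> (S2 y)" for y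
      by (subst avg) simp
  qed (intro continuous_intros cont)
  ultimately have "\<phi> z = \<phi> p" for z by (metis antisym neg_le_iff_le)
  then show ?thesis by metis
qed

section \<open>Positive definite matrices\<close>

lemma sym_pos_def_add:
  assumes "sym_pos_def A" "sym_pos_def B"
  shows "sym_pos_def (A + B)"
proof -
  have "transpose (A + B) = transpose A + transpose B"
    by (simp add: transpose_def vec_eq_iff)
  then show ?thesis
    using assms
    by (simp add: sym_pos_def_def matrix_vector_mult_add_rdistrib inner_add_right add_pos_pos)
qed

lemma sym_pos_def_invertible:
  assumes "sym_pos_def A"
  shows "invertible A"
proof -
  have "x = 0" if "A *v x = 0" for x
    using assms that unfolding sym_pos_def_def by (metis inner_zero_right less_irrefl)
  then show ?thesis
    by (metis invertible_left_inverse matrix_left_invertible_ker)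
qed

lemma sym_pos_def_symmetric:
  assumes "sym_pos_def A"
  shows "(A *v x) \<bullet> y = x \<bullet> (A *v y)"
  using assms vector_transpose_matrix [of x A] dot_lmul_matrix [of x A y]
  by (simp add: sym_pos_def_def)

theorem theorem2p1p11:
  fixes A1 A2 :: "real ^ 'n ^ 'n" and b1 b2 :: "real ^ 'n"
    and T1 T2 :: "real ^ 'n \<Rightarrow> real ^ 'n" and f :: "real ^ 'n \<Rightarrow> real"
  assumes "sym_pos_def A1" and "sym_pos_def A2"
    and "A1 ** A2 = A2 ** A1"
    and "\<And>x. T1 x = A1 *v x + b1" and "\<And>x. T2 x = A2 *v x + b2"
    and "C1 f"
    and "\<And>x. f (T1 x + T2 x) = f (T1 x) + f (T2 x)"
  shows "\<exists>c. \<forall>x. f x = c \<bullet> x"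
proof -
  define A where "A = A1 + A2"
  have spd: "sym_pos_def A" using assms(1,2) by (simp add: A_def sym_pos_def_add)
  note sym = sym_pos_def_symmetric [OF assms(1)] sym_pos_def_symmetric [OF spd]
  obtain N where inv: "A ** N = mat 1"
    using sym_pos_def_invertible [OF spd] by (auto simp: invertible_def)
  have AN: "A *v (N *v x) = x" for x
    by (metis inv matrix_vector_mul_assoc matrix_vector_mul_lid)
  have comm: "A1 *v (A *v x) = A *v (A1 *v x)" for x
  proof -
    have "A1 *v (A2 *v x) = A2 *v (A1 *v x)"
      using assms(3) by (simp add: matrix_vector_mul_assoc)
    then show ?thesis
      by (simp add: A_def matrix_vector_mult_add_rdistrib matrix_vector_right_distrib)
  qed
  define B1 where "B1 = (\<lambda>x. A1 *v (N *v x))"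
  define B2 where "B2 = (\<lambda>x. A2 *v (N *v x))"
  have lin1: "linear B1" and lin2: "linear B2"
    by (auto simp: B1_def B2_def linear_iff matrix_vector_right_distrib matrix_vector_mult_scaleR)
  have B12: "B1 x + B2 x = x" for x
    by (metis A_def AN B1_def B2_def matrix_vector_mult_add_rdistrib)
  then have B2: "B2 x = x - B1 x" for x by (metis add_diff_cancel_left')
  \<comment> \<open>With \<open>x = A *v k\<close> and \<open>y = A *v l\<close>, both sides become
    \<open>k \<bullet> (A1 *v (A *v l))\<close>, because \<open>A1\<close> and \<open>A\<close> are
    symmetric and commute.\<close>
  have symB1: "B1 x \<bullet> y = x \<bullet> B1 y" for x y
    unfolding B1_def by (metis AN comm sym)
  then have symB2: "B2 x \<bullet> y = x \<bullet> B2 y" for x y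
    by (simp add: B2 inner_diff_left inner_diff_right)
  \<comment> \<open>Putting \<open>v = A *v k\<close> gives
    \<open>A1 *v k = m *\<^sub>R (A *v k)\<close>, so \<open>m\<close> is a ratio
    \<open>a / (a + b)\<close> with \<open>a\<close> and \<open>b\<close> positive.\<close>
  have eig1: "0 < m \<and> m < 1" if "v \<noteq> 0" "B1 v = m *\<^sub>R v" for v m
  proof -
    define k where "k = N *v v"
    have v: "v = A *v k" by (simp add: k_def AN)
    have "k \<noteq> 0" using that v by auto
    then have pos: "0 < k \<bullet> (A1 *v k)" "0 < k \<bullet> (A2 *v k)"
      using assms(1,2) by (auto simp: sym_pos_def_def)
    have Ak: "k \<bullet> (A *v k) = k \<bullet> (A1 *v k) + k \<bullet> (A2 *v k)"
      by (simp add: A_def matrix_vector_mult_add_rdistrib inner_add_right)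
    have "A1 *v k = B1 v" by (simp add: B1_def k_def)
    then have "A1 *v k = m *\<^sub>R (A *v k)" using that(2) v by simp
    then have "k \<bullet> (A1 *v k) = m * (k \<bullet> (A *v k))" by simp
    moreover have "0 < k \<bullet> (A *v k)" using pos Ak by linarith
    ultimately have "m = k \<bullet> (A1 *v k) / (k \<bullet> (A *v k))" by simp
    then show ?thesis using pos Ak by simp
  qed
  have eig2: "0 < m \<and> m < 1" if "v \<noteq> 0" "B2 v = m *\<^sub>R v" for v m
  proof -
    have "B1 v = (1 - m) *\<^sub>R v" using that B2 [of v] by (simp add: algebra_simps)
    from eig1 [OF that(1) this] show ?thesis by simp
  qed
  obtain s1 where s1: "0 \<le> s1" "s1 < 1" "\<And>x. norm (B1 x) \<le> s1 * norm x"
    using symmetric_contraction [OF lin1 symB1] eig1 by (metis (no_types, lifting))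
  obtain s2 where s2: "0 \<le> s2" "s2 < 1" "\<And>x. norm (B2 x) \<le> s2 * norm x"
    using symmetric_contraction [OF lin2 symB2] eig2 by (metis (no_types, lifting))
  define s where "s = max s1 s2"
  have s: "0 \<le> s" "s < 1" using s1 s2 by (auto simp: s_def)
  \<comment> \<open>Inverting \<open>y = T1 x + T2 x\<close> makes \<open>T1 x\<close> equal to
    \<open>B1 y + d\<close>. The translation part of \<open>T2 x\<close> is then \<open>- d\<close>,
    since \<open>T1 x + T2 x = y\<close> and \<open>B1 y + B2 y = y\<close>.\<close>
  define d where "d = b1 - B1 (b1 + b2)"
  define S1 where "S1 = (\<lambda>y. B1 y + d)"
  define S2 where "S2 = (\<lambda>y. B2 y - d)"
  have contr: "dist (S1 x) (S1 y) \<le> s * dist x y" "dist (S2 x) (S2 y) \<le> s * dist x y" for x y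
  proof -
    have "s1 * norm (x - y) \<le> s * norm (x - y)" "s2 * norm (x - y) \<le> s * norm (x - y)"
      by (auto simp: s_def intro: mult_right_mono)
    with s1(3) [of "x - y"] s2(3) [of "x - y"]
    show "dist (S1 x) (S1 y) \<le> s * dist x y" "dist (S2 x) (S2 y) \<le> s * dist x y"
      by (auto simp: S1_def S2_def dist_norm linear_diff [OF lin1] linear_diff [OF lin2])
  qed
  have eq: "f y = f (S1 y) + f (S2 y)" for y
  proof -
    define x where "x = N *v (y - (b1 + b2))"
    have "T1 x = S1 y"
      by (simp add: assms(4) x_def S1_def d_def linear_diff [OF lin1] flip: B1_def)
        (simp add: x_def B1_def matrix_vector_mult_diff_distrib)
    moreover have "T2 x = S2 y"
    proof -
      have "T2 x = B2 (y - (b1 + b2)) + b2" by (simp add: assms(5) x_def B2_def)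
      also have "\<dots> = S2 y" by (simp add: S2_def B2 d_def linear_diff [OF lin1])
      finally show ?thesis .
    qed
    moreover have "S1 y + S2 y = y" by (simp add: S1_def S2_def B12)
    ultimately show ?thesis using assms(7) [of x] by simp
  qed
  obtain f' :: "real ^ 'n \<Rightarrow> (real ^ 'n) \<Rightarrow>\<^sub>L real"
    where der: "\<And>x. (f has_derivative blinfun_apply (f' x)) (at x)" and cont: "continuous_on UNIV f'"
    using \<open>C1 f\<close> unfolding C1_def by blast
  have derS: "(S1 has_derivative B1) (at y)" "(S2 has_derivative B2) (at y)" for y
    unfolding S1_def S2_def
    by (auto intro!: derivative_eq_intros linear_imp_has_derivative lin1 lin2)
  have der_eq: "f' y h = f' (S1 y) (B1 h) + f' (S2 y) (B2 h)" for y h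
  proof -
    have "((\<lambda>y. f (S1 y) + f (S2 y)) has_derivative
            (\<lambda>h. f' (S1 y) (B1 h) + f' (S2 y) (B2 h))) (at y)"
      by (intro has_derivative_add has_derivative_compose [OF derS(1) der]
          has_derivative_compose [OF derS(2) der])
    moreover have "f = (\<lambda>y. f (S1 y) + f (S2 y))" using eq by blast
    ultimately have "blinfun_apply (f' y) = (\<lambda>h. f' (S1 y) (B1 h) + f' (S2 y) (B2 h))"
      using has_derivative_unique der by metis
    then show ?thesis by (rule fun_cong)
  qed
  have const_eig: "f' y h = f' 0 h" if h: "B1 h = m *\<^sub>R h" for y h m
  proof (cases "h = 0")
    case False
    have m: "0 < m" "m < 1" using eig1 [OF False h] by auto
    have "B2 h = (1 - m) *\<^sub>R h" by (simp add: B2 h algebra_simps)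
    then have "f' y h = m * f' (S1 y) h + (1 - m) * f' (S2 y) h" for y
      using der_eq [of y h] h by (simp add: blinfun.scaleR_right)
    moreover have "continuous_on UNIV (\<lambda>y. f' y h)"
      by (intro continuous_intros cont)
    ultimately show ?thesis
      using convex_average_const [OF s contr(1) contr(2) _ m] by blast
  qed simp
  have const: "f' y h = f' 0 h" for y h
  proof (rule linear_eq_on_span [of "f' y" "f' 0" "{v. \<exists>m. B1 v = m *\<^sub>R v}"])
    show "h \<in> span {v. \<exists>m. B1 v = m *\<^sub>R v}"
      using symmetric_eigenvectors_span [OF lin1 symB1] by simp
  qed (auto intro: const_eig bounded_linear.linear blinfun.bounded_linear_right)
  have "((\<lambda>x. f x - f' 0 x) has_derivative (\<lambda>h. 0)) (at x within UNIV)" for x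
    using has_derivative_diff [OF der [of x]
        bounded_linear_imp_has_derivative [OF blinfun.bounded_linear_right [of "f' 0"]]]
    unfolding const [of x] by simp
  then obtain e where "\<And>x. f x - f' 0 x = e"
    using has_derivative_zero_constant [OF convex_UNIV] by (metis UNIV_I)
  then have e: "f x = f' 0 x + e" for x by (simp add: diff_eq_eq add.commute)
  \<comment> \<open>The translations \<open>d\<close> and \<open>- d\<close> cancel in the linear
    part, so the functional equation at 0 reads \<open>e = 2 * e\<close>.\<close>
  have "f' 0 0 = f' 0 (S1 0) + f' 0 (S2 0)"
    by (simp add: S1_def S2_def linear_0 [OF lin1] linear_0 [OF lin2] flip: blinfun.add_right)
  then have "e = 0" using eq [of 0] e by simp
  \<comment> \<open>The adjoint at 1 is the vector representing the functional
    \<open>f' 0\<close>.\<close>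
  moreover have "f' 0 x = adjoint (f' 0) 1 \<bullet> x" for x
    using adjoint_works [of "f' 0" x 1]
    by (simp add: bounded_linear.linear blinfun.bounded_linear_right inner_commute)
  ultimately show ?thesis using e by auto
qed

end
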